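(* Let $\mathcal{K}$ be a field, let $\Gamma$ be a finite quiver without oriented cycles, let $\rho$ be a set of relations on $\Gamma$ over $\mathcal{K}$, and let $\Lambda=\mathcal{K}(\Gamma,\rho)$ be the (finite dimensional) path algebra of the quiver $(\Gamma,\rho)$ with relations. Let $\Theta$ be a Lie derivation from $\Lambda$ into itself. Then $\Theta$ is of the standard form, i.e. $\Theta=D+\Phi$ where $D$ is a derivation of $\Lambda$ and $\Phi$ is a $\mathcal{K}$-linear mapping from $\Lambda$ into the center $\mathcal{Z}(\Lambda)$ of $\Lambda$. Moreover, the standard decomposition is unique: if $\Theta=D+\Phi=D'+\Phi'$ are two such decompositions, then $D=D'$ and $\Phi=\Phi'$.
   Context: A quiver $\Gamma=(\Gamma_0,\Gamma_1)$ is an oriented graph with vertex set $\Gamma_0$ and arrow set $\Gamma_1$; it is finite if both sets are finite. An arrow $\alpha$ from $i$ to $j$ has $s(\alpha)=i$, $e(\alpha)=j$. A nontrivial path is an ordered sequence of arrows $p=\alpha_n\cdots\alpha_1$ ($n\ge 1$) with $e(\alpha_m)=s(\alpha_{m+1})$ for $1\le m<n$; $s(p)=s(\alpha_1)$, $e(p)=e(\alpha_n)$. For each vertex $i$ there is a trivial path $e_i$ with $s(e_i)=e(e_i)=i$. An oriented cycle is a nontrivial path $p$ with $s(p)=e(p)$. The path algebra $\mathcal{K}\Gamma$ has the set of all paths as $\mathcal{K}$-basis; the product $xy$ of two paths is their concatenation ($y$ first, then $x$) if $e(y)=s(x)$ and $0$ otherwise; its identity is $\sum_{i\in\Gamma_0}e_i$.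 A relation on $\Gamma$ over $\mathcal{K}$ is a $\mathcal{K}$-linear combination $\sum_i k_ip_i$ of paths with a common start vertex and a common end vertex, each path containing at least $2$ arrows. For a set $\rho$ of relations, $\mathcal{K}(\Gamma,\rho)=\mathcal{K}\Gamma/\langle\rho\rangle$, where $\langle\rho\rangle$ is the two-sided ideal generated by $\rho$. For a $\mathcal{K}$-algebra $\mathcal{A}$ write $[a,b]=ab-ba$. A $\mathcal{K}$-linear map $\Theta:\mathcal{A}\to\mathcal{A}$ is a derivation if $\Theta(ab)=\Theta(a)b+a\Theta(b)$ for all $a,b\in\mathcal{A}$, and a Lie derivation if $\Theta([a,b])=[\Theta(a),b]+[a,\Theta(b)]$ for all $a,b\in\mathcal{A}$. *)

theory Defs
  imports "HOL-Algebra.QuotRing" "HOL-Algebra.Module" "Graph_Theory.Arc_Walk"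
begin

section \<open>Paths in a quiver\<close>

text \<open>
  A quiver is a \<^typ>\<open>('v, 'e) pre_digraph\<close> satisfying \<^locale>\<open>wf_digraph\<close> (loops and parallel
  arrows are allowed), a finite quiver one satisfying \<^locale>\<open>fin_digraph\<close>.
  A path is a pair of its start vertex and the list of its arrows in the order in which they are
  traversed; the path written \<open>\<alpha>_n \<dots> \<alpha>_1\<close> on paper is \<open>(s(\<alpha>_1), [\<alpha>_1, \<dots>, \<alpha>_n])\<close>, and
  \<open>(i, [])\<close> is the trivial path at \<open>i\<close>.
\<close>

type_synonym ('v, 'e) path = "'v \<times> 'e list"

definition paths :: "('v, 'e) pre_digraph \<Rightarrow> ('v, 'e) path set" where
  "paths \<Gamma> = {(i, as). \<exists>j. pre_digraph.awalk \<Gamma> i as j}"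

definition path_start :: "('v, 'e) path \<Rightarrow> 'v" where
  "path_start p = fst p"

definition path_end :: "('v, 'e) pre_digraph \<Rightarrow> ('v, 'e) path \<Rightarrow> 'v" where
  "path_end \<Gamma> p = last (pre_digraph.awalk_verts \<Gamma> (fst p) (snd p))"

definition path_length :: "('v, 'e) path \<Rightarrow> nat" where
  "path_length p = length (snd p)"

definition oriented_cycle :: "('v, 'e) pre_digraph \<Rightarrow> ('v, 'e) path \<Rightarrow> bool" where
  "oriented_cycle \<Gamma> p \<longleftrightarrow> p \<in> paths \<Gamma> \<and> path_length p \<ge> 1 \<and> path_start p = path_end \<Gamma> p"

text \<open>The concatenation \<open>xy\<close> traverses \<open>y\<close> first; it is meaningful if \<open>e(y) = s(x)\<close>.\<close>

definition path_concat :: "('v, 'e) path \<Rightarrow> ('v, 'e) path \<Rightarrow> ('v, 'e) path" where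
  "path_concat x y = (fst y, snd y @ snd x)"


section \<open>Path algebras of quivers with relations\<close>

text \<open>
  Elements of the path algebra are the finitely supported coefficient functions on paths.
  The product is the bilinear extension of concatenation: the coefficient of \<open>p\<close> in \<open>f g\<close> sums
  over the factorisations \<open>p = xy\<close>, of which there are finitely many.
  The identity is the sum of the trivial paths, which lies in the carrier when the quiver has
  finitely many vertices.
\<close>

definition path_algebra ::
    "('v, 'e) pre_digraph \<Rightarrow> ('k::field, ('v, 'e) path \<Rightarrow> 'k) module" where
  "path_algebra \<Gamma> = \<lparr>
     carrier = {f. finite {p. f p \<noteq> 0} \<and> {p. f p \<noteq> 0} \<subseteq> paths \<Gamma>},
     monoid.mult = (\<lambda>f g p.
       \<Sum>(x, y) \<in> {(x, y). x \<in> paths \<Gamma> \<and> y \<in> paths \<Gamma> \<and> path_end \<Gamma> y = path_start x \<and>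
                        path_concat x y = p}. f x * g y),
     one = (\<lambda>p. if \<exists>i \<in> verts \<Gamma>. p = (i, []) then 1 else 0),
     zero = (\<lambda>p. 0),
     add = (\<lambda>f g p. f p + g p),
     smult = (\<lambda>c f p. c * f p)\<rparr>"

definition is_relation ::
    "('v, 'e) pre_digraph \<Rightarrow> (('v, 'e) path \<Rightarrow> 'k::field) \<Rightarrow> bool" where
  "is_relation \<Gamma> r \<longleftrightarrow>
     r \<in> carrier (path_algebra \<Gamma>) \<and>
     (\<exists>i j. \<forall>p. r p \<noteq> 0 \<longrightarrow> path_start p = i \<and> path_end \<Gamma> p = j \<and> path_length p \<ge> 2)"

text \<open>
  The quotient algebra of cosets; scalars act on cosets through representatives, in the style of
  \<^const>\<open>rcoset_mult\<close>.
\<close>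

definition quotient_algebra :: "('k, 'a) module \<Rightarrow> 'a set \<Rightarrow> ('k, 'a set) module" where
  "quotient_algebra A I = \<lparr>
     carrier = carrier (A Quot I),
     monoid.mult = monoid.mult (A Quot I),
     one = one (A Quot I),
     zero = zero (A Quot I),
     add = add (A Quot I),
     smult = (\<lambda>c X. \<Union>x\<in>X. I +>\<^bsub>A\<^esub> (c \<odot>\<^bsub>A\<^esub> x))\<rparr>"

definition path_algebra_rel ::
    "('v, 'e) pre_digraph \<Rightarrow> (('v, 'e) path \<Rightarrow> 'k::field) set
       \<Rightarrow> ('k, (('v, 'e) path \<Rightarrow> 'k) set) module" where
  "path_algebra_rel \<Gamma> \<rho> =
     quotient_algebra (path_algebra \<Gamma>) (Idl\<^bsub>path_algebra \<Gamma>\<^esub> \<rho>)"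


section \<open>Lie derivations\<close>

text \<open>
  In the following \<open>A\<close> is an associative algebra over the field \<^typ>\<open>'k\<close>; maps on \<open>A\<close> matter
  only on the carrier.
\<close>

definition linear_map :: "('k, 'a) module \<Rightarrow> ('a \<Rightarrow> 'a) \<Rightarrow> bool" where
  "linear_map A T \<longleftrightarrow>
     T \<in> carrier A \<rightarrow> carrier A \<and>
     (\<forall>a\<in>carrier A. \<forall>b\<in>carrier A. T (a \<oplus>\<^bsub>A\<^esub> b) = T a \<oplus>\<^bsub>A\<^esub> T b) \<and>
     (\<forall>c. \<forall>a\<in>carrier A. T (c \<odot>\<^bsub>A\<^esub> a) = c \<odot>\<^bsub>A\<^esub> T a)"

definition lie_bracket :: "('k, 'a) module \<Rightarrow> 'a \<Rightarrow> 'a \<Rightarrow> 'a" where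
  "lie_bracket A a b = a \<otimes>\<^bsub>A\<^esub> b \<ominus>\<^bsub>A\<^esub> b \<otimes>\<^bsub>A\<^esub> a"

definition center :: "('k, 'a) module \<Rightarrow> 'a set" where
  "center A = {z \<in> carrier A. \<forall>a\<in>carrier A. z \<otimes>\<^bsub>A\<^esub> a = a \<otimes>\<^bsub>A\<^esub> z}"

definition derivation :: "('k, 'a) module \<Rightarrow> ('a \<Rightarrow> 'a) \<Rightarrow> bool" where
  "derivation A D \<longleftrightarrow> linear_map A D \<and>
     (\<forall>a\<in>carrier A. \<forall>b\<in>carrier A. D (a \<otimes>\<^bsub>A\<^esub> b) = D a \<otimes>\<^bsub>A\<^esub> b \<oplus>\<^bsub>A\<^esub> a \<otimes>\<^bsub>A\<^esub> D b)"

definition lie_derivation :: "('k, 'a) module \<Rightarrow> ('a \<Rightarrow> 'a) \<Rightarrow> bool" where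
  "lie_derivation A T \<longleftrightarrow> linear_map A T \<and>
     (\<forall>a\<in>carrier A. \<forall>b\<in>carrier A.
        T (lie_bracket A a b) = lie_bracket A (T a) b \<oplus>\<^bsub>A\<^esub> lie_bracket A a (T b))"

definition standard_decomposition ::
    "('k, 'a) module \<Rightarrow> ('a \<Rightarrow> 'a) \<Rightarrow> ('a \<Rightarrow> 'a) \<Rightarrow> ('a \<Rightarrow> 'a) \<Rightarrow> bool" where
  "standard_decomposition A T D \<Phi> \<longleftrightarrow>
     derivation A D \<and> linear_map A \<Phi> \<and> \<Phi> \<in> carrier A \<rightarrow> center A \<and>
     (\<forall>a\<in>carrier A. T a = D a \<oplus>\<^bsub>A\<^esub> \<Phi> a)"

end

(*
  The vertex idempotents e_i give a Peirce decomposition of the algebra A. As there are no oriented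
  cycles, e_i A e_i = K e_i, and for i \<noteq> j one of e_i A e_j and e_j A e_i vanishes; nothing else
  about the quiver is needed, and both properties pass to quotients.

  Subtracting an inner derivation from a Lie derivation T makes every T(e_i) diagonal. Applying T to
  a = [e_j, a] = [a, e_i] for a in e_j A e_i, i \<noteq> j, then shows that T preserves e_j A e_i and that
  every T(e_i) is central. Hence \<Phi>(a) = \<Sum>_i T(e_i a e_i) is central-valued and T - \<Phi> is a derivation
  which kills every e_i. For uniqueness, a derivation with central values kills each e_i, because
  D(e_i) = 2 e_i D(e_i), and then each a in e_j A e_i, because D(a) = e_j D(a) e_i = e_j e_i D(a).
*)
theory Submission
  imports Defs "HOL-Algebra.Multiplicative_Group"
begin

section \<open>Unital algebras\<close>

text \<open>The scalar laws are closure and compatibility with sums and products, the rules by which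
  linear maps and corners are computed. Each can be checked on representatives, so quotients by
  ideals satisfy them as well.\<close>

locale unital_algebra = ring A for A :: "('k::field, 'a) module" (structure) +
  assumes smult_closed [simp, intro]: "a \<in> carrier A \<Longrightarrow> c \<odot> a \<in> carrier A"
    and smult_r_distr: "\<lbrakk>a \<in> carrier A; b \<in> carrier A\<rbrakk> \<Longrightarrow> c \<odot> (a \<oplus> b) = c \<odot> a \<oplus> c \<odot> b"
    and smult_assoc_l: "\<lbrakk>a \<in> carrier A; b \<in> carrier A\<rbrakk> \<Longrightarrow> (c \<odot> a) \<otimes> b = c \<odot> (a \<otimes> b)"
    and smult_assoc_r: "\<lbrakk>a \<in> carrier A; b \<in> carrier A\<rbrakk> \<Longrightarrow> a \<otimes> (c \<odot> b) = c \<odot> (a \<otimes> b)"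
begin

text \<open>With both factors zero in \<open>smult_assoc_l\<close>, the left side is a product with
  \<open>\<zero>\<close> and the right side is \<open>c \<odot> \<zero>\<close>.\<close>

lemma smult_zero [simp]: "c \<odot> \<zero> = \<zero>"
  using smult_assoc_l[of \<zero> \<zero> c] by (simp add: smult_closed)

lemma smult_minus: "a \<in> carrier A \<Longrightarrow> c \<odot> (\<ominus> a) = \<ominus> (c \<odot> a)"
  by (metis a_inv_closed l_neg minus_equality smult_closed smult_r_distr smult_zero)

lemma smult_finsum:
  assumes "finite I" "f \<in> I \<rightarrow> carrier A"
  shows "c \<odot> (\<Oplus>i\<in>I. f i) = (\<Oplus>i\<in>I. c \<odot> f i)"
  using assms
proof (induction I rule: finite_induct)
  case (insert i I)
  then have "f \<in> I \<rightarrow> carrier A" "f i \<in> carrier A" by auto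
  moreover have "(\<lambda>i. c \<odot> f i) \<in> I \<rightarrow> carrier A" using calculation by auto
  ultimately show ?case
    using insert by (simp add: finsum_insert smult_r_distr finsum_closed)
qed simp

text \<open>Carries an additively closed property from the summands to a finite sum. It underlies
  the induction over Peirce components and the centrality of \<open>\<Phi>\<close>.\<close>

lemma finsum_pred:
  assumes "finite I" "f \<in> I \<rightarrow> carrier A" "P \<zero>"
    and "\<And>a b. \<lbrakk>a \<in> carrier A; b \<in> carrier A; P a; P b\<rbrakk> \<Longrightarrow> P (a \<oplus> b)"
    and "\<And>i. i \<in> I \<Longrightarrow> P (f i)"
  shows "P (\<Oplus>i\<in>I. f i)"
  using assms(1,2,5)
proof (induction I rule: finite_induct)
  case empty
  then show ?case using assms(3) by simp
next
  case (insert i I)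
  then have f: "f \<in> I \<rightarrow> carrier A" "f i \<in> carrier A" by auto
  then have "P (f i \<oplus> (\<Oplus>i\<in>I. f i))"
    using insert by (intro assms(4)) (auto simp: finsum_closed)
  then show ?case using insert f by (simp add: finsum_insert)
qed

section \<open>Linear maps, derivations and Lie derivations\<close>

lemma linear_map_closed:
  "\<lbrakk>linear_map A T; a \<in> carrier A\<rbrakk> \<Longrightarrow> T a \<in> carrier A"
  by (auto simp: linear_map_def)

lemma linear_map_add:
  "\<lbrakk>linear_map A T; a \<in> carrier A; b \<in> carrier A\<rbrakk> \<Longrightarrow> T (a \<oplus> b) = T a \<oplus> T b"
  by (auto simp: linear_map_def)

lemma linear_map_smult:
  "\<lbrakk>linear_map A T; a \<in> carrier A\<rbrakk> \<Longrightarrow> T (c \<odot> a) = c \<odot> T a"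
  by (auto simp: linear_map_def)

lemma linear_map_zero: "linear_map A T \<Longrightarrow> T \<zero> = \<zero>"
  by (metis add.l_cancel_one' l_zero linear_map_add linear_map_closed zero_closed)

lemma linear_map_minus:
  "\<lbrakk>linear_map A T; a \<in> carrier A\<rbrakk> \<Longrightarrow> T (\<ominus> a) = \<ominus> T a"
  by (metis a_inv_closed l_neg linear_map_add linear_map_closed linear_map_zero minus_equality)

lemma lie_bracket_closed [simp]:
  "\<lbrakk>a \<in> carrier A; b \<in> carrier A\<rbrakk> \<Longrightarrow> lie_bracket A a b \<in> carrier A"
  by (simp add: lie_bracket_def)

lemma linear_map_combine:
  assumes "linear_map A S" "linear_map A T"
  shows "linear_map A (\<lambda>a. S a \<oplus> T a)" "linear_map A (\<lambda>a. S a \<ominus> T a)"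
proof -
  note c = linear_map_closed[OF assms(1)] linear_map_closed[OF assms(2)]
  note r = linear_map_add[OF assms(1)] linear_map_add[OF assms(2)]
    linear_map_smult[OF assms(1)] linear_map_smult[OF assms(2)]
  have "(S a \<oplus> S b) \<oplus> (T a \<oplus> T b) = (S a \<oplus> T a) \<oplus> (S b \<oplus> T b)"
    "(S a \<oplus> S b) \<ominus> (T a \<oplus> T b) = (S a \<ominus> T a) \<oplus> (S b \<ominus> T b)"
    if "a \<in> carrier A" "b \<in> carrier A" for a b
    using c[OF that(1)] c[OF that(2)] by algebra+
  then show "linear_map A (\<lambda>a. S a \<oplus> T a)" "linear_map A (\<lambda>a. S a \<ominus> T a)"
    unfolding linear_map_def by (auto simp: c r smult_r_distr smult_minus minus_eq)
qed

lemma inner_derivation: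
  assumes x: "x \<in> carrier A"
  shows "derivation A (lie_bracket A x)"
proof -
  have "x \<otimes> (a \<oplus> b) \<ominus> (a \<oplus> b) \<otimes> x = (x \<otimes> a \<ominus> a \<otimes> x) \<oplus> (x \<otimes> b \<ominus> b \<otimes> x)"
    "x \<otimes> (a \<otimes> b) \<ominus> (a \<otimes> b) \<otimes> x = (x \<otimes> a \<ominus> a \<otimes> x) \<otimes> b \<oplus> a \<otimes> (x \<otimes> b \<ominus> b \<otimes> x)"
    if "a \<in> carrier A" "b \<in> carrier A" for a b
    using x that by algebra+
  then show ?thesis
    unfolding derivation_def linear_map_def using x
    by (auto simp: lie_bracket_def smult_r_distr smult_minus smult_assoc_l smult_assoc_r minus_eq)
qed

text \<open>Subtract the product rule for \<open>b \<otimes> a\<close> from the one for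
  \<open>a \<otimes> b\<close> and regroup.\<close>

lemma derivation_imp_lie_derivation:
  assumes "derivation A D"
  shows "lie_derivation A D"
proof -
  have D: "linear_map A D" using assms by (simp add: derivation_def)
  note c = linear_map_closed[OF D]
  have "(D a \<otimes> b \<oplus> a \<otimes> D b) \<ominus> (D b \<otimes> a \<oplus> b \<otimes> D a) =
      (D a \<otimes> b \<ominus> b \<otimes> D a) \<oplus> (a \<otimes> D b \<ominus> D b \<otimes> a)"
    if "a \<in> carrier A" "b \<in> carrier A" for a b
    using that c[OF that(1)] c[OF that(2)] by algebra
  then show ?thesis
    using assms c unfolding lie_derivation_def derivation_def
    by (auto simp: lie_bracket_def minus_eq linear_map_add[OF D] linear_map_minus[OF D])
qed

lemma lie_derivation_diff:
  assumes "lie_derivation A S" "lie_derivation A T"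
  shows "lie_derivation A (\<lambda>a. S a \<ominus> T a)"
proof -
  have L: "linear_map A S" "linear_map A T" using assms by (auto simp: lie_derivation_def)
  note c = linear_map_closed[OF L(1)] linear_map_closed[OF L(2)]
  have "((S a \<otimes> b \<ominus> b \<otimes> S a) \<oplus> (a \<otimes> S b \<ominus> S b \<otimes> a)) \<ominus> ((T a \<otimes> b \<ominus> b \<otimes> T a) \<oplus> (a \<otimes> T b \<ominus> T b \<otimes> a))
     = ((S a \<ominus> T a) \<otimes> b \<ominus> b \<otimes> (S a \<ominus> T a)) \<oplus> (a \<otimes> (S b \<ominus> T b) \<ominus> (S b \<ominus> T b) \<otimes> a)"
    if "a \<in> carrier A" "b \<in> carrier A" for a b
    using that c[OF that(1)] c[OF that(2)] by algebra
  then show ?thesis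
    using assms linear_map_combine(2)[OF L] unfolding lie_derivation_def
    by (simp add: lie_bracket_def)
qed

lemma derivation_add:
  assumes "derivation A S" "derivation A T"
  shows "derivation A (\<lambda>a. S a \<oplus> T a)"
proof -
  have L: "linear_map A S" "linear_map A T" using assms by (auto simp: derivation_def)
  note c = linear_map_closed[OF L(1)] linear_map_closed[OF L(2)]
  have "(S a \<otimes> b \<oplus> a \<otimes> S b) \<oplus> (T a \<otimes> b \<oplus> a \<otimes> T b) = (S a \<oplus> T a) \<otimes> b \<oplus> a \<otimes> (S b \<oplus> T b)"
    if "a \<in> carrier A" "b \<in> carrier A" for a b
    using that c[OF that(1)] c[OF that(2)] by algebra
  then show ?thesis
    using assms linear_map_combine(1)[OF L] unfolding derivation_def by simp
qed

lemma derivation_diff: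
  assumes "derivation A S" "derivation A T"
  shows "derivation A (\<lambda>a. S a \<ominus> T a)"
proof -
  have L: "linear_map A S" "linear_map A T" using assms by (auto simp: derivation_def)
  note c = linear_map_closed[OF L(1)] linear_map_closed[OF L(2)]
  have "(S a \<otimes> b \<oplus> a \<otimes> S b) \<ominus> (T a \<otimes> b \<oplus> a \<otimes> T b) = (S a \<ominus> T a) \<otimes> b \<oplus> a \<otimes> (S b \<ominus> T b)"
    if "a \<in> carrier A" "b \<in> carrier A" for a b
    using that c[OF that(1)] c[OF that(2)] by algebra
  then show ?thesis
    using assms linear_map_combine(2)[OF L] unfolding derivation_def by simp
qed

end

section \<open>Peirce decompositions\<close>

text \<open>A complete system of orthogonal idempotents, together with the two traces that the
  absence of oriented cycles leaves in the algebra. As \<open>a\<close> and \<open>b\<close> vary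
  independently in \<open>acyclic\<close>, one of the two components vanishes as a whole. An
  \<open>e i\<close> may be zero, which happens in quotients by large ideals.\<close>

locale peirce = unital_algebra A for A :: "('k::field, 'a) module" (structure) +
  fixes V :: "'v set" and e :: "'v \<Rightarrow> 'a"
  assumes finite_V: "finite V"
    and e_closed [simp]: "i \<in> V \<Longrightarrow> e i \<in> carrier A"
    and e_mult: "\<lbrakk>i \<in> V; j \<in> V\<rbrakk> \<Longrightarrow> e i \<otimes> e j = (if i = j then e i else \<zero>)"
    and e_sum: "(\<Oplus>i\<in>V. e i) = \<one>"
    and corner: "\<lbrakk>i \<in> V; a \<in> carrier A\<rbrakk> \<Longrightarrow> \<exists>c. e i \<otimes> a \<otimes> e i = c \<odot> e i"
    and acyclic: "\<lbrakk>i \<in> V; j \<in> V; i \<noteq> j; a \<in> carrier A; b \<in> carrier A\<rbrakk> \<Longrightarrow>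
      e i \<otimes> a \<otimes> e j = \<zero> \<or> e j \<otimes> b \<otimes> e i = \<zero>"
begin

section \<open>Peirce components of elements\<close>

lemma e_mult_left:
  "\<lbrakk>i \<in> V; j \<in> V; a \<in> carrier A\<rbrakk> \<Longrightarrow> e i \<otimes> (e j \<otimes> a) = (if i = j then e i \<otimes> a else \<zero>)"
  by (auto simp: m_assoc[symmetric] e_mult)

text \<open>Multiply by \<open>\<one> = (\<Oplus>i\<in>V. e i)\<close> on the left and on the
  right.\<close>

lemma peirce_expansion:
  assumes a: "a \<in> carrier A"
  shows "a = (\<Oplus>k\<in>V. \<Oplus>l\<in>V. e k \<otimes> a \<otimes> e l)"
proof -
  have "a = (\<Oplus>k\<in>V. e k) \<otimes> a" using a e_sum by simp
  also have "\<dots> = (\<Oplus>k\<in>V. e k \<otimes> a)" using a finite_V by (intro finsum_ldistr) auto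
  also have "\<dots> = (\<Oplus>k\<in>V. \<Oplus>l\<in>V. e k \<otimes> a \<otimes> e l)"
  proof (rule finsum_cong')
    fix k assume k: "k \<in> V"
    have "e k \<otimes> a = e k \<otimes> a \<otimes> (\<Oplus>l\<in>V. e l)" using a k e_sum by simp
    also have "\<dots> = (\<Oplus>l\<in>V. e k \<otimes> a \<otimes> e l)" using a k finite_V by (intro finsum_rdistr) auto
    finally show "e k \<otimes> a = (\<Oplus>l\<in>V. e k \<otimes> a \<otimes> e l)" .
  qed (use a in \<open>auto intro!: finsum_closed\<close>)
  finally show ?thesis .
qed

text \<open>Every element is a finite sum of components. By \<open>corner\<close> a diagonal
  component is a multiple of an idempotent, and an off-diagonal one satisfies
  \<open>a = e j \<otimes> a \<otimes> e i\<close>, the form in which membership in e_j A e_i is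
  expressed throughout.\<close>

lemma peirce_induct [consumes 1, case_names zero add diag off]:
  assumes a: "a \<in> carrier A"
    and zero: "P \<zero>"
    and add: "\<And>a b. \<lbrakk>a \<in> carrier A; b \<in> carrier A; P a; P b\<rbrakk> \<Longrightarrow> P (a \<oplus> b)"
    and diag: "\<And>i c. i \<in> V \<Longrightarrow> P (c \<odot> e i)"
    and off: "\<And>j i a. \<lbrakk>j \<in> V; i \<in> V; j \<noteq> i; a \<in> carrier A; a = e j \<otimes> a \<otimes> e i\<rbrakk> \<Longrightarrow> P a"
  shows "P a"
proof -
  have comp: "P (e k \<otimes> a \<otimes> e l)" if "k \<in> V" "l \<in> V" for k l
  proof (cases "k = l")
    case True
    then show ?thesis using corner[OF \<open>k \<in> V\<close> a] diag[OF \<open>k \<in> V\<close>] by auto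
  next
    case False
    show ?thesis
      using that a by (intro off[OF that False]) (auto simp: m_assoc e_mult e_mult_left)
  qed
  have row: "P (\<Oplus>l\<in>V. e k \<otimes> a \<otimes> e l)" if k: "k \<in> V" for k
  proof (rule finsum_pred[OF finite_V])
    show "(\<lambda>l. e k \<otimes> a \<otimes> e l) \<in> V \<rightarrow> carrier A" using a k by simp
  qed (fact zero add comp[OF k])+
  have "P (\<Oplus>k\<in>V. \<Oplus>l\<in>V. e k \<otimes> a \<otimes> e l)"
  proof (rule finsum_pred[OF finite_V])
    show "(\<lambda>k. \<Oplus>l\<in>V. e k \<otimes> a \<otimes> e l) \<in> V \<rightarrow> carrier A" using a by (simp add: finsum_closed)
  qed (fact zero add row)+
  then show ?thesis using peirce_expansion[OF a] by simp
qed

lemma peirce_eqI: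
  assumes "a \<in> carrier A" "b \<in> carrier A"
    and "\<And>k l. \<lbrakk>k \<in> V; l \<in> V\<rbrakk> \<Longrightarrow> e k \<otimes> a \<otimes> e l = e k \<otimes> b \<otimes> e l"
  shows "a = b"
proof -
  have "(\<Oplus>k\<in>V. \<Oplus>l\<in>V. e k \<otimes> a \<otimes> e l) = (\<Oplus>k\<in>V. \<Oplus>l\<in>V. e k \<otimes> b \<otimes> e l)"
    using assms by (intro finsum_cong') (auto intro!: finsum_closed)
  then show ?thesis using peirce_expansion assms by metis
qed

lemma off_diagonal_mult:
  assumes "j \<in> V" "i \<in> V" "a \<in> carrier A" "a = e j \<otimes> a \<otimes> e i" "k \<in> V"
  shows "e k \<otimes> a = (if k = j then a else \<zero>)" "a \<otimes> e k = (if k = i then a else \<zero>)"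
proof -
  \<comment> \<open>The products are computed on the expanded form; the hypothesis then folds that
    form back into \<open>a\<close>.\<close>
  have "e k \<otimes> (e j \<otimes> a \<otimes> e i) = (if k = j then e j \<otimes> a \<otimes> e i else \<zero>)"
    "e j \<otimes> a \<otimes> e i \<otimes> e k = (if k = i then e j \<otimes> a \<otimes> e i else \<zero>)"
    using assms(1-3,5) by (auto simp: m_assoc e_mult e_mult_left)
  then show "e k \<otimes> a = (if k = j then a else \<zero>)" "a \<otimes> e k = (if k = i then a else \<zero>)"
    using assms(4) by simp_all
qed

section \<open>Uniqueness of the standard decomposition\<close>

lemma central_derivation_zero:
  assumes D: "derivation A D" and Z: "\<And>a. a \<in> carrier A \<Longrightarrow> D a \<in> center A"
    and a: "a \<in> carrier A"
  shows "D a = \<zero>"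
proof -
  have L: "linear_map A D" using D by (simp add: derivation_def)
  note cl = linear_map_closed[OF L]
  have comm: "D x \<otimes> y = y \<otimes> D x" if "x \<in> carrier A" "y \<in> carrier A" for x y
    using Z[OF that(1)] that by (auto simp: center_def)
  have mult: "D (x \<otimes> y) = D x \<otimes> y \<oplus> x \<otimes> D y" if "x \<in> carrier A" "y \<in> carrier A" for x y
    using D that by (auto simp: derivation_def)
  have De: "D (e i) = \<zero>" if i: "i \<in> V" for i
  proof -
    have 1: "D (e i) = e i \<otimes> D (e i) \<oplus> e i \<otimes> D (e i)"
      using mult[of "e i" "e i"] comm[of "e i" "e i"] i by (simp add: e_mult)
    \<comment> \<open>Multiplying by \<open>e i\<close> yields x = x + x for x =
      \<open>e i \<otimes> D (e i)\<close>, so x = 0 in every characteristic, with no division by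
      2.\<close>
    have "e i \<otimes> D (e i) = e i \<otimes> (e i \<otimes> D (e i) \<oplus> e i \<otimes> D (e i))"
      by (rule arg_cong[OF 1])
    also have "\<dots> = e i \<otimes> D (e i) \<oplus> e i \<otimes> D (e i)"
      using i cl[of "e i"] by (simp add: r_distr e_mult_left)
    finally have "e i \<otimes> D (e i) = \<zero>" using i cl[of "e i"]
      by (metis add.l_cancel_one' e_closed m_closed)
    then show ?thesis using 1 by (metis l_zero zero_closed)
  qed
  show ?thesis
    using a
  proof (induction a rule: peirce_induct)
    case zero
    show ?case using L by (rule linear_map_zero)
  next
    case (add a b)
    then show ?case by (simp add: linear_map_add[OF L])
  next
    case (diag i c)
    then show ?case by (simp add: linear_map_smult[OF L] De)
  next
    case (off j i a)
    note m = off_diagonal_mult[OF off(1,2,4,5)]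
    have "D a = D (e j \<otimes> a)" using m(1)[of j] off(1-4) by simp
    also have "\<dots> = e j \<otimes> D a" using mult[of "e j" a] off(1-4) De cl by simp
    finally have 1: "D a = e j \<otimes> D a" .
    have "D a = D (a \<otimes> e i)" using m(2)[of i] off(1-4) by simp
    also have "\<dots> = D a \<otimes> e i" using mult[of a "e i"] off(1-4) De cl by simp
    \<comment> \<open>Centrality brings \<open>e i\<close> to the left, where it meets the
      orthogonal idempotent \<open>e j\<close>.\<close>
    also have "\<dots> = e i \<otimes> D a" using comm off(1-4) by simp
    finally have 2: "D a = e i \<otimes> D a" .
    have "D a = e j \<otimes> (e i \<otimes> D a)" using 1 2 by metis
    also have "\<dots> = \<zero>" using off(1-4) cl by (simp add: e_mult_left)
    finally show ?case .
  qed
qed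

text \<open>The derivation D - D' equals \<open>\<Phi>'\<close> - \<open>\<Phi>\<close>, so its
  values are central and it vanishes by \<open>central_derivation_zero\<close>.\<close>

lemma standard_decomposition_unique:
  assumes "standard_decomposition A T D \<Phi>" "standard_decomposition A T D' \<Phi>'"
    and a: "a \<in> carrier A"
  shows "D a = D' a \<and> \<Phi> a = \<Phi>' a"
proof -
  have der: "derivation A D" "derivation A D'"
    and \<Phi>: "\<And>a. a \<in> carrier A \<Longrightarrow> \<Phi> a \<in> center A" "\<And>a. a \<in> carrier A \<Longrightarrow> \<Phi>' a \<in> center A"
    and eq: "\<And>a. a \<in> carrier A \<Longrightarrow> D a \<oplus> \<Phi> a = D' a \<oplus> \<Phi>' a"
    using assms unfolding standard_decomposition_def by auto
  have cl: "D a \<in> carrier A" "D' a \<in> carrier A" "\<Phi> a \<in> carrier A" "\<Phi>' a \<in> carrier A"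
    if "a \<in> carrier A" for a
    using der \<Phi> that linear_map_closed by (auto simp: derivation_def center_def)
  have diff: "D a \<ominus> D' a = \<Phi>' a \<ominus> \<Phi> a" if a: "a \<in> carrier A" for a
  proof -
    have "D a \<ominus> D' a = (D a \<oplus> \<Phi> a) \<ominus> \<Phi> a \<ominus> D' a" using cl[OF a] by algebra
    also have "\<dots> = (D' a \<oplus> \<Phi>' a) \<ominus> \<Phi> a \<ominus> D' a" using eq[OF a] by simp
    also have "\<dots> = \<Phi>' a \<ominus> \<Phi> a" using cl[OF a] by algebra
    finally show ?thesis .
  qed
  have "D a \<ominus> D' a = \<zero>"
  proof (rule central_derivation_zero[OF derivation_diff[OF der] _ a])
    fix a assume a: "a \<in> carrier A"
    show "D a \<ominus> D' a \<in> center A"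
      using \<Phi>[OF a] unfolding diff[OF a] center_def
      by (auto simp: minus_eq l_distr r_distr l_minus r_minus)
  qed
  then have "D a = D' a" "\<Phi>' a = \<Phi> a"
    using diff[OF a] cl[OF a] by (metis r_right_minus_eq)+
  then show ?thesis by simp
qed

section \<open>Existence of the standard decomposition\<close>

lemma diagonal_commute:
  assumes d: "d \<in> carrier A" "\<And>k l. \<lbrakk>k \<in> V; l \<in> V; k \<noteq> l\<rbrakk> \<Longrightarrow> e k \<otimes> d \<otimes> e l = \<zero>"
    and m: "m \<in> V"
  shows "e m \<otimes> d = d \<otimes> e m"
proof (rule peirce_eqI)
  fix k l assume kl: "k \<in> V" "l \<in> V"
  \<comment> \<open>Left multiplication by \<open>e m\<close> keeps row m of \<open>d\<close>, right
    multiplication keeps column m. For a diagonal \<open>d\<close> both leave just the entry (m,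
    m).\<close>
  have "e k \<otimes> (e m \<otimes> d) \<otimes> e l = (if k = m then e k \<otimes> d \<otimes> e l else \<zero>)"
    "e k \<otimes> (d \<otimes> e m) \<otimes> e l = (if m = l then e k \<otimes> d \<otimes> e l else \<zero>)"
    using kl m d(1) by (auto simp: e_mult_left e_mult m_assoc)
  then show "e k \<otimes> (e m \<otimes> d) \<otimes> e l = e k \<otimes> (d \<otimes> e m) \<otimes> e l"
    using d(2)[OF kl] by auto
qed (use d m in auto)

context
  fixes T
  assumes T: "lie_derivation A T"
begin

lemma T_linear: "linear_map A T"
  using T by (simp add: lie_derivation_def)

lemmas T_simps = linear_map_closed[OF T_linear] linear_map_add[OF T_linear]
  linear_map_smult[OF T_linear] linear_map_zero[OF T_linear]

lemma T_bracket:
  "\<lbrakk>a \<in> carrier A; b \<in> carrier A\<rbrakk> \<Longrightarrow>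
    T (lie_bracket A a b) = lie_bracket A (T a) b \<oplus> lie_bracket A a (T b)"
  using T by (simp add: lie_derivation_def)

text \<open>Apply \<open>T\<close> to [e_i, e_j] = 0 and take the component in row k and column l.
  The four conditionals are the four products in the two resulting brackets. With j = l this relates
  row i of \<open>T (e i)\<close> to column l of \<open>T (e l)\<close>, and it kills entries of
  \<open>T (e i)\<close> outside row i and column i.\<close>

lemma T_idempotents:
  assumes "i \<in> V" "j \<in> V" "k \<in> V" "l \<in> V" "k \<noteq> l"
  shows "(if l = j then e k \<otimes> T (e i) \<otimes> e l else \<zero>) \<ominus> (if k = j then e k \<otimes> T (e i) \<otimes> e l else \<zero>) \<oplus>
    ((if k = i then e k \<otimes> T (e j) \<otimes> e l else \<zero>) \<ominus> (if l = i then e k \<otimes> T (e j) \<otimes> e l else \<zero>)) = \<zero>"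
proof -
  note c = T_simps(1)
  have "lie_bracket A (e i) (e j) = \<zero>"
    using assms by (auto simp: lie_bracket_def e_mult)
  then have "\<zero> = T (lie_bracket A (e i) (e j))"
    by (simp add: T_simps)
  also have "\<dots> = lie_bracket A (T (e i)) (e j) \<oplus> lie_bracket A (e i) (T (e j))"
    using assms by (simp add: T_bracket)
  finally have "lie_bracket A (T (e i)) (e j) \<oplus> lie_bracket A (e i) (T (e j)) = \<zero>" by simp
  then have "\<zero> = e k \<otimes> (lie_bracket A (T (e i)) (e j) \<oplus> lie_bracket A (e i) (T (e j))) \<otimes> e l"
    using assms by simp
  also have "\<dots> = (if l = j then e k \<otimes> T (e i) \<otimes> e l else \<zero>) \<ominus> (if k = j then e k \<otimes> T (e i) \<otimes> e l else \<zero>) \<oplus>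
    ((if k = i then e k \<otimes> T (e j) \<otimes> e l else \<zero>) \<ominus> (if l = i then e k \<otimes> T (e j) \<otimes> e l else \<zero>))"
    using assms c[of "e i"] c[of "e j"]
    by (simp add: lie_bracket_def minus_eq l_distr r_distr l_minus r_minus m_assoc e_mult e_mult_left)
  finally show ?thesis by simp
qed

lemma inner_adjustment:
  obtains x where "x \<in> carrier A"
    "\<And>i k l. \<lbrakk>i \<in> V; k \<in> V; l \<in> V; k \<noteq> l\<rbrakk> \<Longrightarrow> e k \<otimes> (T (e i) \<ominus> lie_bracket A x (e i)) \<otimes> e l = \<zero>"
proof
  \<comment> \<open>Chosen so that \<open>x\<close> and \<open>T (e l)\<close> have the same column
    l, that is, \<open>x \<otimes> e l = T (e l) \<otimes> e l\<close>. Off the diagonal, [x, e_i]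
    then agrees with \<open>T (e i)\<close> in column i by construction, in row i by
    \<open>T_idempotents\<close>, and elsewhere because both vanish.\<close>
  define x where "x = (\<Oplus>l\<in>V. T (e l) \<otimes> e l)"
  note c = T_simps(1)
  show x: "x \<in> carrier A" unfolding x_def using c by (auto intro!: finsum_closed)
  have xe: "x \<otimes> e l = T (e l) \<otimes> e l" if l: "l \<in> V" for l
  proof -
    have "x \<otimes> e l = (\<Oplus>m\<in>V. T (e m) \<otimes> e m \<otimes> e l)"
      unfolding x_def using c l finite_V by (intro finsum_ldistr) auto
    also have "\<dots> = (\<Oplus>m\<in>V. if l = m then T (e m) \<otimes> e m else \<zero>)"
      using c l by (intro finsum_cong') (auto simp: m_assoc e_mult)
    also have "\<dots> = T (e l) \<otimes> e l"
      using c l finite_V by (intro add.finprod_singleton) auto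
    finally show ?thesis .
  qed
  fix i k l assume *: "i \<in> V" "k \<in> V" "l \<in> V" "k \<noteq> l"
  have "e k \<otimes> (T (e i) \<ominus> lie_bracket A x (e i)) \<otimes> e l = e k \<otimes> T (e i) \<otimes> e l \<ominus>
     ((if l = i then e k \<otimes> (x \<otimes> e l) else \<zero>) \<ominus> (if k = i then e k \<otimes> (x \<otimes> e l) else \<zero>))"
    using * c[of "e i"] x
    by (simp add: lie_bracket_def minus_eq l_distr r_distr l_minus r_minus m_assoc e_mult e_mult_left minus_add)
  also have "\<dots> = e k \<otimes> T (e i) \<otimes> e l \<ominus> ((if l = i then e k \<otimes> T (e l) \<otimes> e l else \<zero>)
      \<ominus> (if k = i then e k \<otimes> T (e l) \<otimes> e l else \<zero>))"
    using * c by (simp add: xe m_assoc)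
  also have "\<dots> = \<zero>"
  proof -
    \<comment> \<open>Column i, row i, and the entries outside both.\<close>
    consider "l = i" "k \<noteq> i" | "k = i" "l \<noteq> i" | "k \<noteq> i" "l \<noteq> i" using * by blast
    then show ?thesis
    proof cases
      case 1
      then show ?thesis using * c by (simp add: minus_eq r_neg)
    next
      case 2
      then show ?thesis using T_idempotents[of i l k l] * c by (simp add: minus_eq)
    next
      case 3
      then show ?thesis using T_idempotents[of i l k l] * c by (simp add: minus_eq)
    qed
  qed
  finally show "e k \<otimes> (T (e i) \<ominus> lie_bracket A x (e i)) \<otimes> e l = \<zero>" .
qed

section \<open>Lie derivations with diagonal values on the idempotents\<close>

context
  assumes T_diag: "\<And>i k l. \<lbrakk>i \<in> V; k \<in> V; l \<in> V; k \<noteq> l\<rbrakk> \<Longrightarrow> e k \<otimes> T (e i) \<otimes> e l = \<zero>"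
begin

text \<open>Both identities a = [e_j, a] and a = [a, e_i] are put through \<open>T\<close> and
  compared entry by entry. The first part reads off the entries other than (j, i), the second the
  entry (j, i) itself.\<close>

lemma T_off_diagonal:
  assumes "j \<in> V" "i \<in> V" "j \<noteq> i" "a \<in> carrier A" "a = e j \<otimes> a \<otimes> e i"
  shows "T a = e j \<otimes> T a \<otimes> e i"
    and "\<And>m. m \<in> V \<Longrightarrow> T (e m) \<otimes> a = a \<otimes> T (e m)"
proof -
  note cl = T_simps(1)
  note m = off_diagonal_mult[OF assms(1,2,4,5)]
  have dc: "e n \<otimes> T (e h) = T (e h) \<otimes> e n" if "n \<in> V" "h \<in> V" for n h
    using that cl T_diag by (intro diagonal_commute) auto
  have dc2: "e n \<otimes> (T (e h) \<otimes> y) = T (e h) \<otimes> (e n \<otimes> y)" if "n \<in> V" "h \<in> V" "y \<in> carrier A" for n h y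
    using that cl dc by (metis e_closed m_assoc)
  have m3: "a \<otimes> (e n \<otimes> y) = (if n = i then a \<otimes> y else \<zero>)" if "n \<in> V" "y \<in> carrier A" for n y
    using that assms(1-4) m(2)[of n] by (simp add: m_assoc[symmetric])
  have m4: "e n \<otimes> (a \<otimes> y) = (if n = j then a \<otimes> y else \<zero>)" if "n \<in> V" "y \<in> carrier A" for n y
    using that assms(1-4) m(1)[of n] by (simp add: m_assoc[symmetric])
  \<comment> \<open>Being diagonal, \<open>T (e h)\<close> commutes with all idempotents, so its
    bracket with \<open>a\<close> stays in e_j A e_i.\<close>
  have da: "e k \<otimes> lie_bracket A (T (e h)) a \<otimes> e l = (if k = j \<and> l = i then lie_bracket A (T (e h)) a else \<zero>)"
    if "h \<in> V" "k \<in> V" "l \<in> V" for h k l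
  proof -
    have "e k \<otimes> lie_bracket A (T (e h)) a \<otimes> e l =
      T (e h) \<otimes> (e k \<otimes> (a \<otimes> e l)) \<ominus> e k \<otimes> (a \<otimes> (e l \<otimes> T (e h)))"
      using that assms(1-4) cl
      by (simp add: lie_bracket_def minus_eq l_distr r_distr l_minus r_minus m_assoc dc2 dc)
    then show ?thesis
      using that assms(1-4) cl by (auto simp: m m3 m4 lie_bracket_def minus_eq)
  qed
  have ad: "lie_bracket A a (T (e h)) = \<ominus> lie_bracket A (T (e h)) a" if "h \<in> V" for h
    using that assms(4) cl[of "e h"] unfolding lie_bracket_def by (simp add: minus_eq minus_add a_comm)
  have Ta1: "T a = lie_bracket A (T (e j)) a \<oplus> lie_bracket A (e j) (T a)"
    using T_bracket[of "e j" a] assms(1-4) m[of j] by (simp add: lie_bracket_def minus_eq)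
  have eq1: "e k \<otimes> T a \<otimes> e l = (if k = j \<and> l = i then lie_bracket A (T (e j)) a else \<zero>) \<oplus>
      ((if k = j then e k \<otimes> T a \<otimes> e l else \<zero>) \<ominus> (if l = j then e k \<otimes> T a \<otimes> e l else \<zero>))"
    if "k \<in> V" "l \<in> V" for k l
  proof -
    have "e k \<otimes> T a \<otimes> e l = e k \<otimes> (lie_bracket A (T (e j)) a \<oplus> lie_bracket A (e j) (T a)) \<otimes> e l"
      by (rule arg_cong[OF Ta1])
    also have "\<dots> = e k \<otimes> lie_bracket A (T (e j)) a \<otimes> e l \<oplus> e k \<otimes> lie_bracket A (e j) (T a) \<otimes> e l"
      using that cl assms(1-4) by (simp add: l_distr r_distr)
    also have "e k \<otimes> lie_bracket A (e j) (T a) \<otimes> e l =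
       (if k = j then e k \<otimes> T a \<otimes> e l else \<zero>) \<ominus> (if l = j then e k \<otimes> T a \<otimes> e l else \<zero>)"
      using that cl assms(1-4)
      by (simp add: lie_bracket_def minus_eq l_distr r_distr l_minus r_minus m_assoc e_mult e_mult_left)
    finally show ?thesis using that da assms(1-4) by simp
  qed
  have Ta2: "T a = lie_bracket A (T a) (e i) \<oplus> lie_bracket A a (T (e i))"
    using T_bracket[of a "e i"] assms(1-4) m[of i] by (simp add: lie_bracket_def minus_eq)
  have eq2: "e k \<otimes> T a \<otimes> e l = 
      ((if l = i then e k \<otimes> T a \<otimes> e l else \<zero>) \<ominus> (if k = i then e k \<otimes> T a \<otimes> e l else \<zero>)) \<ominus>
      (if k = j \<and> l = i then lie_bracket A (T (e i)) a else \<zero>)"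
    if "k \<in> V" "l \<in> V" for k l
  proof -
    have "e k \<otimes> T a \<otimes> e l = e k \<otimes> (lie_bracket A (T a) (e i) \<ominus> lie_bracket A (T (e i)) a) \<otimes> e l"
      using Ta2 ad[OF assms(2)] by (metis minus_eq)
    also have "\<dots> = e k \<otimes> lie_bracket A (T a) (e i) \<otimes> e l \<ominus> e k \<otimes> lie_bracket A (T (e i)) a \<otimes> e l"
      using that cl assms(1-4) by (simp add: l_distr r_distr minus_eq l_minus r_minus)
    also have "e k \<otimes> lie_bracket A (T a) (e i) \<otimes> e l =
       (if l = i then e k \<otimes> T a \<otimes> e l else \<zero>) \<ominus> (if k = i then e k \<otimes> T a \<otimes> e l else \<zero>)"
      using that cl assms(1-4)
      by (simp add: lie_bracket_def minus_eq l_distr r_distr l_minus r_minus m_assoc e_mult e_mult_left)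
    finally show ?thesis using that da assms(1-4) by simp
  qed
  have comp0: "e k \<otimes> T a \<otimes> e l = \<zero>" if kl: "k \<in> V" "l \<in> V" "\<not> (k = j \<and> l = i)" for k l
  proof (cases "k = i \<and> l = j")
    case True
    \<comment> \<open>The two equations only give \<open>2 e\<^sub>i T(a) e\<^sub>j = 0\<close> here, which says nothing in characteristic 2.\<close>
    from acyclic[OF assms(1-3) assms(4) cl[OF assms(4)]]
    show ?thesis
    proof
      assume "e j \<otimes> a \<otimes> e i = \<zero>"
      then have "a = \<zero>" using assms(5) by simp
      then show ?thesis using kl by (simp add: T_simps)
    qed (use True in simp)
  next
    case False
    \<comment> \<open>Apart from (j, i), \<open>eq1\<close> forces an entry to vanish unless exactly
      one of k = j, l = j holds, and \<open>eq2\<close> unless exactly one of k = i, l = i holds.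
      Only (j, i) and (i, j) survive both, and these are excluded here.\<close>
    show ?thesis
      using eq1[OF kl(1,2)] eq2[OF kl(1,2)] kl False assms(1-4) cl[of a]
      by (cases "k = j"; cases "l = j"; cases "k = i") (simp_all add: minus_eq)
  qed
  show Ta: "T a = e j \<otimes> T a \<otimes> e i"
  proof (rule peirce_eqI)
    fix k l assume kl: "k \<in> V" "l \<in> V"
    then show "e k \<otimes> T a \<otimes> e l = e k \<otimes> (e j \<otimes> T a \<otimes> e i) \<otimes> e l"
      using comp0[OF kl] assms(1-4) cl[of a] by (auto simp: m_assoc e_mult e_mult_left)
  qed (use assms(1-4) cl in auto)
  note mT = off_diagonal_mult[OF assms(1,2) cl[OF assms(4)] Ta]
  fix n assume n: "n \<in> V"
  have "lie_bracket A (T (e n)) a = \<zero>"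
  proof -
    \<comment> \<open>For n = j and n = i, the entry (j, i) of \<open>T a\<close> cancels from
      \<open>eq1\<close> and \<open>eq2\<close> respectively and leaves the bracket. For any other
      n, \<open>e n\<close> annihilates both \<open>a\<close> and \<open>T a\<close> from either
      side, so \<open>T\<close> applied to [e_n, a] = 0 gives the claim.\<close>
    consider "n = j" | "n = i" | "n \<noteq> j" "n \<noteq> i" by blast
    then show ?thesis
    proof cases
      case 1
      then show ?thesis using eq1[of j i] assms(1-4) cl[of a] cl[of "e j"]
        by (simp add: minus_eq Ta[symmetric])
    next
      case 2
      then show ?thesis using eq2[of j i] assms(1-4) cl[of a] cl[of "e i"]
        by (simp add: minus_eq Ta[symmetric])
    next
      case 3
      have "T \<zero> = lie_bracket A (T (e n)) a"
        using 3 n T_bracket[of "e n" a] assms(1-4) cl m[of n] mT[of n]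
        by (simp add: lie_bracket_def minus_eq)
      then show ?thesis by (simp add: T_simps)
    qed
  qed
  then show "T (e n) \<otimes> a = a \<otimes> T (e n)"
    using n assms(4) cl by (simp add: lie_bracket_def)
qed

text \<open>A diagonal element commutes with the idempotents, and \<open>T_off_diagonal\<close>
  covers the off-diagonal elements; these generate the algebra additively.\<close>

lemma T_idempotent_central:
  assumes h: "h \<in> V"
  shows "T (e h) \<in> center A"
proof -
  have d: "T (e h) \<in> carrier A" using h by (simp add: T_simps)
  have "T (e h) \<otimes> a = a \<otimes> T (e h)" if "a \<in> carrier A" for a
    using that
  proof (induction a rule: peirce_induct)
    case zero
    then show ?case using d by simp
  next
    case (add a b)
    then show ?case using d by (simp add: l_distr r_distr)
  next
    case (diag i c)
    then have "e i \<otimes> T (e h) = T (e h) \<otimes> e i"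
      using h d T_diag by (intro diagonal_commute) auto
    then show ?case using diag d by (simp add: smult_assoc_l smult_assoc_r)
  next
    case (off j i a)
    then show ?case using T_off_diagonal(2) h by blast
  qed
  then show ?thesis using d by (simp add: center_def)
qed

lemma T_standard: "\<exists>D \<Phi>. standard_decomposition A T D \<Phi>"
proof -
  note cl = T_simps(1)
  define \<Phi> where "\<Phi> a = (\<Oplus>i\<in>V. T (e i \<otimes> a \<otimes> e i))" for a
  have Pi: "(\<lambda>i. T (e i \<otimes> a \<otimes> e i)) \<in> V \<rightarrow> carrier A" if "a \<in> carrier A" for a
    using that cl by auto
  have \<Phi>_add: "\<Phi> (a \<oplus> b) = \<Phi> a \<oplus> \<Phi> b" if "a \<in> carrier A" "b \<in> carrier A" for a b
  proof -
    have "\<Phi> (a \<oplus> b) = (\<Oplus>i\<in>V. T (e i \<otimes> a \<otimes> e i) \<oplus> T (e i \<otimes> b \<otimes> e i))"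
      unfolding \<Phi>_def using that cl
      by (intro finsum_cong') (auto simp: l_distr r_distr T_simps)
    also have "\<dots> = \<Phi> a \<oplus> \<Phi> b" unfolding \<Phi>_def using that by (intro finsum_addf Pi)
    finally show ?thesis .
  qed
  have \<Phi>_smult: "\<Phi> (c \<odot> a) = c \<odot> \<Phi> a" if "a \<in> carrier A" for a c
  proof -
    have "\<Phi> (c \<odot> a) = (\<Oplus>i\<in>V. c \<odot> T (e i \<otimes> a \<otimes> e i))"
      unfolding \<Phi>_def using that cl
      by (intro finsum_cong') (auto simp: smult_assoc_l smult_assoc_r T_simps)
    also have "\<dots> = c \<odot> \<Phi> a" unfolding \<Phi>_def
      by (rule smult_finsum[symmetric]) (use finite_V Pi that in auto)
    finally show ?thesis .
  qed
  \<comment> \<open>Each argument of \<open>T\<close> in the sum is a scalar multiple of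
    \<open>e i\<close>, and \<open>T (e i)\<close> is central.\<close>
  have \<Phi>_center: "\<Phi> a \<in> center A" if a: "a \<in> carrier A" for a
    unfolding \<Phi>_def
  proof (rule finsum_pred[OF finite_V Pi[OF a]])
    fix i assume i: "i \<in> V"
    then obtain c where "e i \<otimes> a \<otimes> e i = c \<odot> e i" using corner a by blast
    then show "T (e i \<otimes> a \<otimes> e i) \<in> center A"
      using T_idempotent_central[OF i] i
      by (auto simp: T_simps center_def smult_assoc_l smult_assoc_r)
  qed (auto simp: center_def l_distr r_distr)
  have \<Phi>_closed: "\<Phi> a \<in> carrier A" if "a \<in> carrier A" for a
    using \<Phi>_center[OF that] by (simp add: center_def)
  have \<Phi>_linear: "linear_map A \<Phi>"
    unfolding linear_map_def using \<Phi>_add \<Phi>_smult \<Phi>_closed by blast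
  have \<Phi>_e: "\<Phi> (e h) = T (e h)" if h: "h \<in> V" for h
  proof -
    have "\<Phi> (e h) = (\<Oplus>i\<in>V. if h = i then T (e i) else \<zero>)"
      unfolding \<Phi>_def using h cl by (intro finsum_cong') (auto simp: e_mult T_simps)
    also have "\<dots> = T (e h)" using h cl finite_V by (intro add.finprod_singleton) auto
    finally show ?thesis .
  qed
  have \<Phi>_off: "\<Phi> a = \<zero>" if "j \<in> V" "i \<in> V" "j \<noteq> i" "a \<in> carrier A" "a = e j \<otimes> a \<otimes> e i" for j i a
  proof -
    have "\<Phi> a = (\<Oplus>k\<in>V. \<zero>)"
      unfolding \<Phi>_def using off_diagonal_mult[OF that(1,2,4,5)] that(1-4)
      by (intro finsum_cong') (auto simp: T_simps)
    then show ?thesis by (simp add: finsum_zero)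
  qed
  define D where "D a = T a \<ominus> \<Phi> a" for a
  have D_linear: "linear_map A D"
    unfolding D_def by (rule linear_map_combine(2)[OF T_linear \<Phi>_linear])
  note D_simps = linear_map_closed[OF D_linear] linear_map_add[OF D_linear]
    linear_map_smult[OF D_linear] linear_map_zero[OF D_linear]
  have D_e: "D (e i) = \<zero>" if "i \<in> V" for i
    using that cl unfolding D_def by (simp add: \<Phi>_e)
  have D_off: "D a = T a" if "j \<in> V" "i \<in> V" "j \<noteq> i" "a \<in> carrier A" "a = e j \<otimes> a \<otimes> e i" for j i a
    unfolding D_def \<Phi>_off[OF that] using cl that(4) by (simp add: minus_eq)
  have D_corner: "D a = e j \<otimes> D a \<otimes> e i"
    if "j \<in> V" "i \<in> V" "j \<noteq> i" "a \<in> carrier A" "a = e j \<otimes> a \<otimes> e i" for j i a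
    using T_off_diagonal(1)[OF that] D_off[OF that] by simp
  \<comment> \<open>Peirce induction in both factors. \<open>D\<close> kills the idempotents, agrees
    with \<open>T\<close> off the diagonal, and preserves every off-diagonal component.\<close>
  have D_mult: "D (a \<otimes> b) = D a \<otimes> b \<oplus> a \<otimes> D b" if "a \<in> carrier A" "b \<in> carrier A" for a b
    using that(1)
  proof (induction a rule: peirce_induct)
    case zero
    show ?case using that(2) by (simp add: D_simps)
  next
    case (add x y)
    then have "(D x \<otimes> b \<oplus> x \<otimes> D b) \<oplus> (D y \<otimes> b \<oplus> y \<otimes> D b) =
        (D x \<oplus> D y) \<otimes> b \<oplus> (x \<oplus> y) \<otimes> D b"
      using D_simps(1)[of x] D_simps(1)[of y] D_simps(1)[of b] that(2) by algebra
    then show ?case using add that(2) by (simp add: l_distr[of x y b] D_simps)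
  next
    case (diag i c)
    \<comment> \<open>Left multiplication by \<open>e i\<close> keeps or kills a component, and
      \<open>D\<close> respects components, so the two operations commute.\<close>
    have "D (e i \<otimes> b) = e i \<otimes> D b"
      using that(2)
    proof (induction b rule: peirce_induct)
      case (diag k c)
      then show ?case using \<open>i \<in> V\<close> by (auto simp: D_simps D_e smult_assoc_r e_mult)
    next
      case (off k l y)
      show ?case
        using off_diagonal_mult(1)[OF off(1,2,4,5), of i]
          off_diagonal_mult(1)[OF off(1,2) D_simps(1)[OF off(4)] D_corner[OF off], of i] \<open>i \<in> V\<close>
        by (simp add: D_simps)
    qed (use \<open>i \<in> V\<close> in \<open>simp_all add: D_simps r_distr\<close>)
    then show ?case using \<open>i \<in> V\<close> that(2) by (simp add: smult_assoc_l D_simps D_e)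
  next
    case (off j i a)
    note a = off
    note mult_a = off_diagonal_mult[OF a(1,2,4,5)]
      off_diagonal_mult[OF a(1,2) D_simps(1)[OF a(4)] D_corner[OF a]]
    show ?case
      using that(2)
    proof (induction b rule: peirce_induct)
      case zero
      show ?case using a(4) by (simp add: D_simps)
    next
      case (add x y)
      then have "(D a \<otimes> x \<oplus> a \<otimes> D x) \<oplus> (D a \<otimes> y \<oplus> a \<otimes> D y) =
          D a \<otimes> (x \<oplus> y) \<oplus> a \<otimes> (D x \<oplus> D y)"
        using D_simps(1)[of x] D_simps(1)[of y] D_simps(1)[of a] a(4) by algebra
      then show ?case using add a(4) by (simp add: r_distr[of x y a] D_simps)
    next
      case (diag k c)
      then show ?case using mult_a[of k] a(4)
        by (simp add: smult_assoc_r D_simps D_e)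
    next
      case (off k l b)
      note mult_b = off_diagonal_mult[OF off(1,2,4,5)]
        off_diagonal_mult[OF off(1,2) D_simps(1)[OF off(4)] D_corner[OF off]]
      have prod: "x \<otimes> y = \<zero>"
        if "x \<in> carrier A" "y \<in> carrier A" "p \<in> V" "q \<in> V" "p \<noteq> q" "x \<otimes> e p = x" "e q \<otimes> y = y" for x y p q
      proof -
        have "x \<otimes> y = (x \<otimes> e p) \<otimes> (e q \<otimes> y)" using that by simp
        also have "\<dots> = x \<otimes> (e p \<otimes> (e q \<otimes> y))" using that(1-4) by (simp add: m_assoc)
        also have "\<dots> = \<zero>" using that(1-5) by (simp add: e_mult_left)
        finally show ?thesis .
      qed
      have c: "D a \<in> carrier A" "D b \<in> carrier A" using a(4) off(4) by (simp_all add: D_simps)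
      have Dab: "D a = T a" "D b = T b" using D_off[OF a] D_off[OF off] by simp_all
      \<comment> \<open>Here \<open>a\<close> lies in e_j A e_i and \<open>b\<close> in e_k A e_l.
        The factors either fail to compose, or lie in opposite components, one of which is zero by
        \<open>acyclic\<close>, or have a product that is again off-diagonal.\<close>
      consider "i \<noteq> k" | "i = k" "l = j" | "i = k" "l \<noteq> j" by blast
      then show ?case
      proof cases
        case 1
        have "a \<otimes> b = \<zero>" "D a \<otimes> b = \<zero>" "a \<otimes> D b = \<zero>"
          using mult_a[of i] mult_b[of k] a(1,2,4) off(1,2,4) c
          by (auto intro!: prod[OF _ _ a(2) off(1) 1])
        then show ?thesis by (simp add: D_simps)
      next
        case 2
        have "a = \<zero> \<or> b = \<zero>"
          using acyclic[OF a(1,2,3,4) off(4)] a(5) off(5) 2 by simp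
        then show ?thesis using a(4) off(4) c by (auto simp: D_simps)
      next
        case 3
        \<comment> \<open>All products in the reverse order vanish, so each bracket reduces to a
          product and the Lie rule for \<open>T\<close> becomes the product rule for
          \<open>D\<close>.\<close>
        have zero: "b \<otimes> a = \<zero>" "b \<otimes> D a = \<zero>" "D b \<otimes> a = \<zero>"
          using mult_a[of j] mult_b[of l] a(1,2,4) off(1,2,4) c
          by (auto intro!: prod[OF _ _ off(2) a(1) 3(2)])
        have "a \<otimes> b = e j \<otimes> (a \<otimes> b) \<otimes> e l"
          using mult_a(1)[of j] mult_b(2)[of l] a(1,2,4) off(1,2,4)
          by (metis e_closed m_assoc m_closed)
        then have "D (a \<otimes> b) = T (a \<otimes> b)"
          using a(1,4) off(2,4) 3 by (intro D_off[of j l]) auto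
        also have "\<dots> = T (lie_bracket A a b)"
          using a(4) off(4) zero by (simp add: lie_bracket_def minus_eq)
        also have "\<dots> = lie_bracket A (D a) b \<oplus> lie_bracket A a (D b)"
          using T_bracket[OF a(4) off(4)] Dab by simp
        also have "\<dots> = D a \<otimes> b \<oplus> a \<otimes> D b"
          using a(4) off(4) c zero by (simp add: lie_bracket_def minus_eq)
        finally show ?thesis .
      qed
    qed
  qed
  show ?thesis
  proof (intro exI)
    show "standard_decomposition A T D \<Phi>"
      unfolding standard_decomposition_def derivation_def
      using D_linear D_mult \<Phi>_linear \<Phi>_center cl \<Phi>_closed
      by (auto simp: D_def minus_eq a_assoc l_neg)
  qed
qed

end

end

text \<open>The inner derivation from \<open>inner_adjustment\<close> reduces the claim to the
  diagonal case; afterwards it is absorbed into D, while \<open>\<Phi>\<close> stays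
  unchanged.\<close>

lemma lie_derivation_standard:
  assumes T: "lie_derivation A T"
  shows "\<exists>D \<Phi>. standard_decomposition A T D \<Phi>"
proof -
  obtain x where x: "x \<in> carrier A"
    and d: "\<And>i k l. \<lbrakk>i \<in> V; k \<in> V; l \<in> V; k \<noteq> l\<rbrakk> \<Longrightarrow> e k \<otimes> (T (e i) \<ominus> lie_bracket A x (e i)) \<otimes> e l = \<zero>"
    using inner_adjustment[OF T] by blast
  note I = inner_derivation[OF x]
  have L: "lie_derivation A (\<lambda>a. T a \<ominus> lie_bracket A x a)"
    by (intro lie_derivation_diff T derivation_imp_lie_derivation I)
  obtain D \<Phi> where D: "standard_decomposition A (\<lambda>a. T a \<ominus> lie_bracket A x a) D \<Phi>"
    using T_standard[OF L, OF d] by blast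
  have "T a = D a \<oplus> lie_bracket A x a \<oplus> \<Phi> a" if a: "a \<in> carrier A" for a
  proof -
    have c: "T a \<in> carrier A" "D a \<in> carrier A" "\<Phi> a \<in> carrier A" "lie_bracket A x a \<in> carrier A"
      using T D a x linear_map_closed
      by (auto simp: lie_derivation_def derivation_def standard_decomposition_def)
    have "T a = (T a \<ominus> lie_bracket A x a) \<oplus> lie_bracket A x a" using c by algebra
    also have "\<dots> = (D a \<oplus> \<Phi> a) \<oplus> lie_bracket A x a"
      using D a by (simp add: standard_decomposition_def)
    also have "\<dots> = D a \<oplus> lie_bracket A x a \<oplus> \<Phi> a" using c by algebra
    finally show ?thesis .
  qed
  then have "standard_decomposition A T (\<lambda>a. D a \<oplus> lie_bracket A x a) \<Phi>"
    using D derivation_add[OF _ I] by (simp add: standard_decomposition_def)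
  then show ?thesis by blast
qed

end

section \<open>The path algebra\<close>

text \<open>Names the index set of the convolution product, so that its finiteness and its
  reindexing can be stated.\<close>

definition path_factors ::
    "('v, 'e) pre_digraph \<Rightarrow> ('v, 'e) path \<Rightarrow> (('v, 'e) path \<times> ('v, 'e) path) set" where
  "path_factors \<Gamma> p = {(x, y). x \<in> paths \<Gamma> \<and> y \<in> paths \<Gamma> \<and> path_end \<Gamma> y = path_start x \<and>
     path_concat x y = p}"

text \<open>The trivial path e_i as a basis element of the path algebra.\<close>

definition vertex_idempotent :: "'v \<Rightarrow> ('v, 'e) path \<Rightarrow> 'k::field" where
  "vertex_idempotent i p = (if p = (i, []) then 1 else 0)"

lemma path_algebra_simps [simp]:
  "carrier (path_algebra \<Gamma>) = {f. finite {p. f p \<noteq> 0} \<and> {p. f p \<noteq> 0} \<subseteq> paths \<Gamma>}"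
  "(f \<otimes>\<^bsub>path_algebra \<Gamma>\<^esub> g) = (\<lambda>p. \<Sum>(x, y)\<in>path_factors \<Gamma> p. f x * g y)"
  "\<one>\<^bsub>path_algebra \<Gamma>\<^esub> = (\<lambda>p. if \<exists>i \<in> verts \<Gamma>. p = (i, []) then 1 else 0)"
  "\<zero>\<^bsub>path_algebra \<Gamma>\<^esub> = (\<lambda>p. 0)"
  "f \<oplus>\<^bsub>path_algebra \<Gamma>\<^esub> g = (\<lambda>p. f p + g p)"
  "c \<odot>\<^bsub>path_algebra \<Gamma>\<^esub> f = (\<lambda>p. c * f p)"
  by (simp_all add: path_algebra_def path_factors_def)

lemma path_end_Nil [simp]: "path_end \<Gamma> (i, []) = i"
  by (simp add: path_end_def pre_digraph.awalk_verts.simps)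

section \<open>Paths, their factorisations and the convolution product\<close>

context wf_digraph
begin

lemma mem_paths_iff: "p \<in> paths G \<longleftrightarrow> awalk (path_start p) (snd p) (path_end G p)"
  by (cases p) (auto simp: paths_def path_start_def path_end_def)

lemma trivial_mem_paths [simp]: "(i, []) \<in> paths G \<longleftrightarrow> i \<in> verts G"
  by (metis awalk_Nil_iff fst_conv mem_paths_iff path_end_Nil path_start_def snd_conv)

lemma path_end_append: "path_end G (i, as @ bs) = path_end G (path_end G (i, as), bs)"
  by (simp add: path_end_def awlast_append)

lemma append_mem_paths_iff:
  "(i, as @ bs) \<in> paths G \<longleftrightarrow> (i, as) \<in> paths G \<and> (path_end G (i, as), bs) \<in> paths G"
  by (simp add: mem_paths_iff path_start_def path_end_def awlast_append)

lemma path_end_in_verts: "p \<in> paths G \<Longrightarrow> path_end G p \<in> verts G"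
  by (auto simp: mem_paths_iff)

lemma path_start_in_verts: "p \<in> paths G \<Longrightarrow> path_start p \<in> verts G"
  by (auto simp: mem_paths_iff)

lemma path_concat_in_paths:
  assumes "x \<in> paths G" "y \<in> paths G" "path_end G y = path_start x"
  shows "path_concat x y \<in> paths G"
  using assms by (cases x; cases y) (simp add: path_concat_def path_start_def append_mem_paths_iff)

text \<open>A factorisation is determined by the place at which the arrow list of \<open>p\<close>
  is cut.\<close>

lemma finite_path_factors: "finite (path_factors G p)"
proof (rule finite_subset)
  show "path_factors G p \<subseteq> (\<lambda>n. ((path_end G (fst p, take n (snd p)), drop n (snd p)),
      (fst p, take n (snd p)))) ` {..length (snd p)}"
  proof
    fix xy assume "xy \<in> path_factors G p"
    then obtain i as j bs where "xy = ((j, as), (i, bs))" "path_end G (i, bs) = j" "p = (i, bs @ as)"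
      by (auto simp: path_factors_def path_concat_def path_start_def)
    then show "xy \<in> (\<lambda>n. ((path_end G (fst p, take n (snd p)), drop n (snd p)),
      (fst p, take n (snd p)))) ` {..length (snd p)}"
      by (intro image_eqI[of _ _ "length bs"]) auto
  qed
qed simp

lemma path_factors_empty: "p \<notin> paths G \<Longrightarrow> path_factors G p = {}"
  using path_concat_in_paths by (auto simp: path_factors_def)

text \<open>In p = xy with x trivial, necessarily y = p and x sits at the end of p, so a single
  summand survives. The form of \<open>u\<close> covers vertex idempotents and the identity
  alike.\<close>

lemma trivial_mult_left:
  assumes "\<And>x. u x \<noteq> 0 \<Longrightarrow> snd x = []"
  shows "(u \<otimes>\<^bsub>path_algebra G\<^esub> f) p = (if p \<in> paths G then u (path_end G p, []) * f p else 0)"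
proof (cases "p \<in> paths G")
  case True
  have "(\<Sum>(x, y)\<in>path_factors G p. u x * f y) = (\<Sum>(x, y)\<in>{((path_end G p, []), p)}. u x * f y)"
  proof (rule sum.mono_neutral_right[OF finite_path_factors])
    show "{((path_end G p, []), p)} \<subseteq> path_factors G p"
      using True by (auto simp: path_factors_def path_concat_def path_start_def path_end_in_verts)
    show "\<forall>xy\<in>path_factors G p - {((path_end G p, []), p)}. (case xy of (x, y) \<Rightarrow> u x * f y) = 0"
      using assms by (fastforce simp: path_factors_def path_concat_def path_start_def)
  qed
  then show ?thesis using True by simp
qed (simp add: path_factors_empty)

lemma trivial_mult_right:
  assumes "\<And>x. u x \<noteq> 0 \<Longrightarrow> snd x = []"
  shows "(f \<otimes>\<^bsub>path_algebra G\<^esub> u) p = (if p \<in> paths G then f p * u (path_start p, []) else 0)"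
proof (cases "p \<in> paths G")
  case True
  have "(\<Sum>(x, y)\<in>path_factors G p. f x * u y) = (\<Sum>(x, y)\<in>{(p, (path_start p, []))}. f x * u y)"
  proof (rule sum.mono_neutral_right[OF finite_path_factors])
    show "{(p, (path_start p, []))} \<subseteq> path_factors G p"
      using True path_start_in_verts[OF True]
      by (auto simp: path_factors_def path_concat_def path_start_def)
    show "\<forall>xy\<in>path_factors G p - {(p, (path_start p, []))}. (case xy of (x, y) \<Rightarrow> f x * u y) = 0"
      using assms by (fastforce simp: path_factors_def path_concat_def path_start_def)
  qed
  then show ?thesis using True by simp
qed (simp add: path_factors_empty)

lemma vertex_idempotent_mult_left:
  "(vertex_idempotent i \<otimes>\<^bsub>path_algebra G\<^esub> f) p = (if p \<in> paths G \<and> path_end G p = i then f p else 0)"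
  by (subst trivial_mult_left) (auto simp: vertex_idempotent_def split: if_splits)

lemma vertex_idempotent_mult_right:
  "(f \<otimes>\<^bsub>path_algebra G\<^esub> vertex_idempotent i) p = (if p \<in> paths G \<and> path_start p = i then f p else 0)"
  by (subst trivial_mult_right) (auto simp: vertex_idempotent_def split: if_splits)

text \<open>In particular, e_j A e_i is spanned by the paths from i to j, which turns the Peirce
  conditions into statements about paths.\<close>

lemma corner_coefficients:
  "(vertex_idempotent j \<otimes>\<^bsub>path_algebra G\<^esub> f \<otimes>\<^bsub>path_algebra G\<^esub> vertex_idempotent i) p =
     (if p \<in> paths G \<and> path_start p = i \<and> path_end G p = j then f p else 0)"
  by (simp only: vertex_idempotent_mult_left vertex_idempotent_mult_right) simp

lemma path_algebra_mult_closed: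
  assumes "f \<in> carrier (path_algebra G)" "g \<in> carrier (path_algebra G)"
  shows "f \<otimes>\<^bsub>path_algebra G\<^esub> g \<in> carrier (path_algebra G)"
proof -
  let ?S = "{p. (\<Sum>(x, y)\<in>path_factors G p. f x * g y) \<noteq> 0}"
  have *: "\<exists>x y. (x, y) \<in> path_factors G p \<and> f x \<noteq> 0 \<and> g y \<noteq> 0" if "p \<in> ?S" for p
  proof (rule ccontr)
    assume "\<not> ?thesis"
    then have "(\<Sum>(x, y)\<in>path_factors G p. f x * g y) = 0" by (intro sum.neutral) auto
    then show False using that by simp
  qed
  \<comment> \<open>The support of the product consists of concatenations of paths from the two
    finite supports.\<close>
  have "?S \<subseteq> (\<lambda>(x, y). path_concat x y) ` ({p. f p \<noteq> 0} \<times> {p. g p \<noteq> 0})"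
  proof
    fix p assume "p \<in> ?S"
    then obtain x y where "(x, y) \<in> path_factors G p" "f x \<noteq> 0" "g y \<noteq> 0" using * by blast
    then show "p \<in> (\<lambda>(x, y). path_concat x y) ` ({p. f p \<noteq> 0} \<times> {p. g p \<noteq> 0})"
      by (intro image_eqI[of _ _ "(x, y)"]) (auto simp: path_factors_def)
  qed
  then have "finite ?S" using assms by (auto elim: finite_subset)
  moreover have "?S \<subseteq> paths G" using path_factors_empty by fastforce
  ultimately show ?thesis by simp
qed

lemma path_algebra_assoc:
  "(f \<otimes>\<^bsub>path_algebra G\<^esub> g) \<otimes>\<^bsub>path_algebra G\<^esub> h = f \<otimes>\<^bsub>path_algebra G\<^esub> (g \<otimes>\<^bsub>path_algebra G\<^esub> h)"
proof
  fix p
  have "((f \<otimes>\<^bsub>path_algebra G\<^esub> g) \<otimes>\<^bsub>path_algebra G\<^esub> h) p =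
    (\<Sum>uz\<in>path_factors G p. \<Sum>xy\<in>path_factors G (fst uz). f (fst xy) * g (snd xy) * h (snd uz))"
    by (simp add: case_prod_beta sum_distrib_right)
  also have "\<dots> = (\<Sum>(uz, xy)\<in>(SIGMA uz:path_factors G p. path_factors G (fst uz)).
      f (fst xy) * g (snd xy) * h (snd uz))"
    by (intro sum.Sigma) (auto simp: finite_path_factors)
  also have "\<dots> = (\<Sum>(xw, yz)\<in>(SIGMA xw:path_factors G p. path_factors G (snd xw)).
      f (fst xw) * (g (fst yz) * h (snd yz)))"
    \<comment> \<open>Both index sets enumerate the factorisations p = xyz: the pair ((xy, z), (x,
      y)) corresponds to ((x, yz), (y, z)).\<close>
    by (rule sum.reindex_bij_witness[of _
          "\<lambda>(xw, yz). ((path_concat (fst xw) (fst yz), snd yz), (fst xw, fst yz))"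
          "\<lambda>(uz, xy). ((fst xy, path_concat (snd xy) (snd uz)), (snd xy, snd uz))"])
      (auto simp: path_factors_def path_concat_def path_start_def append_mem_paths_iff
        path_end_append mult.assoc)
  also have "\<dots> = (\<Sum>xw\<in>path_factors G p. \<Sum>yz\<in>path_factors G (snd xw).
      f (fst xw) * (g (fst yz) * h (snd yz)))"
    by (intro sum.Sigma[symmetric]) (auto simp: finite_path_factors)
  also have "\<dots> = (f \<otimes>\<^bsub>path_algebra G\<^esub> (g \<otimes>\<^bsub>path_algebra G\<^esub> h)) p"
    by (simp add: case_prod_beta sum_distrib_left)
  finally show "((f \<otimes>\<^bsub>path_algebra G\<^esub> g) \<otimes>\<^bsub>path_algebra G\<^esub> h) p =
    (f \<otimes>\<^bsub>path_algebra G\<^esub> (g \<otimes>\<^bsub>path_algebra G\<^esub> h)) p" .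
qed

end

section \<open>The path algebra of a finite quiver\<close>

context fin_digraph
begin

lemma path_algebra_add_closed:
  assumes "f \<in> carrier (path_algebra G)" "g \<in> carrier (path_algebra G)"
  shows "f \<oplus>\<^bsub>path_algebra G\<^esub> g \<in> carrier (path_algebra G)"
proof -
  have "{p. f p + g p \<noteq> 0} \<subseteq> {p. f p \<noteq> 0} \<union> {p. g p \<noteq> 0}" by auto
  with assms show ?thesis by (auto elim: finite_subset)
qed

lemma path_algebra_smult_closed:
  assumes "f \<in> carrier (path_algebra G)"
  shows "c \<odot>\<^bsub>path_algebra G\<^esub> f \<in> carrier (path_algebra G)"
proof -
  have "{p. c * f p \<noteq> 0} \<subseteq> {p. f p \<noteq> 0}" by auto
  with assms show ?thesis by (auto elim: finite_subset)
qed

text \<open>The support of the identity has one trivial path for each vertex, so it is finite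
  because the vertex set is.\<close>

lemma path_algebra_one_closed: "\<one>\<^bsub>path_algebra G\<^esub> \<in> carrier (path_algebra G)"
proof -
  have "{p. \<exists>i\<in>verts G. p = (i, [])} = (\<lambda>i. (i, [])) ` verts G" by auto
  then show ?thesis by auto
qed

lemma ring_path_algebra: "ring (path_algebra G)"
proof (rule ringI)
  show "abelian_group (path_algebra G)"
  proof (rule abelian_groupI)
    fix f :: "('a, 'b) path \<Rightarrow> 'k::field" assume f: "f \<in> carrier (path_algebra G)"
    then show "\<exists>g\<in>carrier (path_algebra G). g \<oplus>\<^bsub>path_algebra G\<^esub> f = \<zero>\<^bsub>path_algebra G\<^esub>"
      by (intro bexI[of _ "\<lambda>p. - f p"]) auto
  qed (use path_algebra_add_closed in \<open>auto simp: algebra_simps\<close>)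
  show "monoid (path_algebra G)"
  proof (rule monoidI)
    fix f :: "('a, 'b) path \<Rightarrow> 'k::field" assume f: "f \<in> carrier (path_algebra G)"
    have "(\<one>\<^bsub>path_algebra G\<^esub> \<otimes>\<^bsub>path_algebra G\<^esub> f) p = f p"
      "(f \<otimes>\<^bsub>path_algebra G\<^esub> \<one>\<^bsub>path_algebra G\<^esub>) p = f p" for p
      using f
      by (subst trivial_mult_left trivial_mult_right;
          auto split: if_splits simp: path_end_in_verts path_start_in_verts)+
    then show "\<one>\<^bsub>path_algebra G\<^esub> \<otimes>\<^bsub>path_algebra G\<^esub> f = f" "f \<otimes>\<^bsub>path_algebra G\<^esub> \<one>\<^bsub>path_algebra G\<^esub> = f"
      by blast+
  qed (rule path_algebra_mult_closed path_algebra_one_closed path_algebra_assoc; assumption)+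
qed (simp_all add: case_prod_beta algebra_simps sum.distrib)

lemma unital_algebra_path_algebra: "unital_algebra (path_algebra G)"
proof (intro unital_algebra.intro ring_path_algebra unital_algebra_axioms.intro)
qed (use path_algebra_smult_closed in \<open>auto simp: case_prod_beta algebra_simps sum_distrib_left\<close>)

text \<open>Without oriented cycles the only path from i to i is trivial, which gives
  \<open>corner\<close>; a path from i to j and one from j to i would concatenate to an oriented
  cycle, which gives \<open>acyclic\<close>.\<close>

lemma peirce_path_algebra:
  assumes acyclic: "\<not> (\<exists>p. oriented_cycle G p)"
  shows "peirce (path_algebra G :: ('k::field, ('a, 'b) path \<Rightarrow> 'k) module) (verts G) vertex_idempotent"
proof -
  interpret P: unital_algebra "path_algebra G :: ('k::field, ('a, 'b) path \<Rightarrow> 'k) module"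
    by (rule unital_algebra_path_algebra)
  let ?e = "vertex_idempotent :: 'a \<Rightarrow> ('a, 'b) path \<Rightarrow> 'k"
  have e_closed: "?e i \<in> carrier (path_algebra G)" if "i \<in> verts G" for i
    using that by (auto simp: vertex_idempotent_def)
  \<comment> \<open>Ring sums of the idempotents are evaluated coefficientwise, in order to
    recognise their total as the identity.\<close>
  have finsum_apply: "(\<Oplus>\<^bsub>path_algebra G\<^esub>i\<in>I. ?e i) p = (\<Sum>i\<in>I. ?e i p)"
    if "finite I" "I \<subseteq> verts G" for I p
    using that
  proof (induction I rule: finite_induct)
    case (insert i I)
    then have "?e \<in> I \<rightarrow> carrier (path_algebra G)" "?e i \<in> carrier (path_algebra G)"
      using e_closed by blast+
    then have "(\<Oplus>\<^bsub>path_algebra G\<^esub>i\<in>insert i I. ?e i) = ?e i \<oplus>\<^bsub>path_algebra G\<^esub> (\<Oplus>\<^bsub>path_algebra G\<^esub>i\<in>I. ?e i)"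
      using insert by (intro P.finsum_insert) auto
    then show ?case using insert by simp
  qed simp
  show ?thesis
  proof (intro peirce.intro P.unital_algebra_axioms peirce_axioms.intro)
    fix i j assume ij: "i \<in> verts G" "j \<in> verts G"
    show "?e i \<otimes>\<^bsub>path_algebra G\<^esub> ?e j = (if i = j then ?e i else \<zero>\<^bsub>path_algebra G\<^esub>)"
      using ij by (intro ext, subst vertex_idempotent_mult_left) (auto simp: vertex_idempotent_def)
  next
    have "(\<Sum>i\<in>verts G. ?e i p) = (if \<exists>i\<in>verts G. p = (i, []) then 1 else 0)" for p
      by (cases p; cases "snd p = []") (auto simp: vertex_idempotent_def)
    then show "(\<Oplus>\<^bsub>path_algebra G\<^esub>i\<in>verts G. ?e i) = \<one>\<^bsub>path_algebra G\<^esub>"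
      by (auto simp: finsum_apply)
  next
    fix i f assume i: "i \<in> verts G"
    have "snd p = []" if "p \<in> paths G" "path_start p = path_end G p" for p
      using acyclic that unfolding oriented_cycle_def path_length_def
      by (metis One_nat_def Suc_leI length_greater_0_conv)
    then have "p = (i, [])" if "p \<in> paths G" "path_start p = i" "path_end G p = i" for p
      using that by (metis path_start_def prod.collapse)
    then have "?e i \<otimes>\<^bsub>path_algebra G\<^esub> f \<otimes>\<^bsub>path_algebra G\<^esub> ?e i = f (i, []) \<odot>\<^bsub>path_algebra G\<^esub> ?e i"
      using i by (intro ext, subst corner_coefficients) (auto simp: vertex_idempotent_def path_start_def)
    then show "\<exists>c. ?e i \<otimes>\<^bsub>path_algebra G\<^esub> f \<otimes>\<^bsub>path_algebra G\<^esub> ?e i = c \<odot>\<^bsub>path_algebra G\<^esub> ?e i" by blast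
  next
    fix i j and f g :: "('a, 'b) path \<Rightarrow> 'k" assume ij: "i \<in> verts G" "j \<in> verts G" "i \<noteq> j"
    have "\<not> (p \<in> paths G \<and> path_start p = j \<and> path_end G p = i \<and>
       q \<in> paths G \<and> path_start q = i \<and> path_end G q = j)" for p q
    proof
      assume *: "p \<in> paths G \<and> path_start p = j \<and> path_end G p = i \<and>
       q \<in> paths G \<and> path_start q = i \<and> path_end G q = j"
      then have "snd q \<noteq> []" using ij(3) by (metis path_end_Nil path_start_def prod.collapse)
      then have "oriented_cycle G (path_concat p q)"
        using * by (cases p; cases q) (auto simp: oriented_cycle_def path_length_def path_concat_def
            path_start_def Suc_le_eq append_mem_paths_iff path_end_append)
      then show False using acyclic by blast
    qed
    \<comment> \<open>Since no pair of such paths exists, one of the two families is empty, and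
      hence one of the two components is zero.\<close>
    then have "(\<forall>p. \<not> (p \<in> paths G \<and> path_start p = j \<and> path_end G p = i)) \<or>
       (\<forall>q. \<not> (q \<in> paths G \<and> path_start q = i \<and> path_end G q = j))" by blast
    then show "?e i \<otimes>\<^bsub>path_algebra G\<^esub> f \<otimes>\<^bsub>path_algebra G\<^esub> ?e j = \<zero>\<^bsub>path_algebra G\<^esub> \<or>
       ?e j \<otimes>\<^bsub>path_algebra G\<^esub> g \<otimes>\<^bsub>path_algebra G\<^esub> ?e i = \<zero>\<^bsub>path_algebra G\<^esub>"
      unfolding fun_eq_iff corner_coefficients by auto
  qed (use e_closed in auto)
qed

end

section \<open>Quotients\<close>

context unital_algebra
begin

context
  fixes I
  assumes ideal: "ideal I A"
begin

interpretation ideal I A by (rule ideal)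

abbreviation "Q \<equiv> quotient_algebra A I"

lemma Q_cosets:
  "X \<in> carrier Q \<Longrightarrow> \<exists>x\<in>carrier A. X = I +> x"
  "x \<in> carrier A \<Longrightarrow> I +> x \<in> carrier Q"
  by (auto simp: quotient_algebra_def FactRing_simps)

lemma Q_ops:
  "\<lbrakk>x \<in> carrier A; y \<in> carrier A\<rbrakk> \<Longrightarrow> (I +> x) \<otimes>\<^bsub>Q\<^esub> (I +> y) = I +> x \<otimes> y"
  "\<lbrakk>x \<in> carrier A; y \<in> carrier A\<rbrakk> \<Longrightarrow> (I +> x) \<oplus>\<^bsub>Q\<^esub> (I +> y) = I +> (x \<oplus> y)"
  "\<one>\<^bsub>Q\<^esub> = I +> \<one>"
  "\<zero>\<^bsub>Q\<^esub> = I +> \<zero>"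
  by (simp_all add: quotient_algebra_def FactRing_simps rcoset_mult_add a_rcos_sum
      a_coset_add_zero[OF a_subset])

text \<open>The union over representatives collapses to one coset, as every representative yields
  the same one.\<close>

lemma Q_smult:
  assumes x: "x \<in> carrier A"
  shows "c \<odot>\<^bsub>Q\<^esub> (I +> x) = I +> c \<odot> x"
proof -
  have eq: "I +> c \<odot> y = I +> c \<odot> x" if y: "y \<in> I +> x" for y
  proof -
    obtain h where h: "h \<in> I" "y = h \<oplus> x" using y by (auto simp: a_r_coset_def')
    have hc: "h \<in> carrier A" using h(1) by (rule a_Hcarr)
    \<comment> \<open>An ideal of the ring absorbs scalars, because scaling is multiplication by
      \<open>c \<odot> \<one>\<close>.\<close>
    have "c \<odot> h = (c \<odot> \<one>) \<otimes> h" using hc by (simp add: smult_assoc_l)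
    then have "c \<odot> h \<in> I" using h(1) I_l_closed by simp
    then show ?thesis
      using h(2) hc x by (metis a_rcos_const a_rcos_sum a_coset_add_assoc a_subset smult_closed smult_r_distr)
  qed
  have "c \<odot>\<^bsub>Q\<^esub> (I +> x) = (\<Union>y\<in>I +> x. I +> c \<odot> y)"
    by (simp add: quotient_algebra_def)
  also have "\<dots> = (\<Union>y\<in>I +> x. I +> c \<odot> x)"
    by (intro SUP_cong refl eq)
  also have "\<dots> = I +> c \<odot> x"
    using a_rcos_self[OF x] by blast
  finally show ?thesis .
qed

lemma unital_algebra_quotient: "unital_algebra Q"
proof -
  have carrier: "carrier Q = (\<lambda>x. I +> x) ` carrier A"
    using Q_cosets by auto
  have "ring Q"
  proof (rule ringI)
    show "abelian_group Q"
    proof (rule abelian_groupI)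
      fix X assume "X \<in> carrier Q"
      then obtain x where "x \<in> carrier A" "X = I +> x" using Q_cosets(1) by blast
      then show "\<exists>Y\<in>carrier Q. Y \<oplus>\<^bsub>Q\<^esub> X = \<zero>\<^bsub>Q\<^esub>"
        by (intro bexI[of _ "I +> \<ominus> x"]) (simp_all add: Q_ops Q_cosets l_neg)
    qed (auto simp: carrier Q_ops a_ac)
    show "monoid Q"
      by (rule monoidI) (auto simp: carrier Q_ops m_assoc)
  qed (auto simp: carrier Q_ops l_distr r_distr)
  moreover have "unital_algebra_axioms Q"
  proof (rule unital_algebra_axioms.intro)
    fix X c assume "X \<in> carrier Q"
    then show "c \<odot>\<^bsub>Q\<^esub> X \<in> carrier Q"
      using Q_cosets Q_smult smult_closed by metis
  next
    fix X Y c assume "X \<in> carrier Q" "Y \<in> carrier Q"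
    then obtain x y where xy: "x \<in> carrier A" "y \<in> carrier A" "X = I +> x" "Y = I +> y"
      using Q_cosets(1) by meson
    show "c \<odot>\<^bsub>Q\<^esub> (X \<oplus>\<^bsub>Q\<^esub> Y) = c \<odot>\<^bsub>Q\<^esub> X \<oplus>\<^bsub>Q\<^esub> c \<odot>\<^bsub>Q\<^esub> Y"
      "(c \<odot>\<^bsub>Q\<^esub> X) \<otimes>\<^bsub>Q\<^esub> Y = c \<odot>\<^bsub>Q\<^esub> (X \<otimes>\<^bsub>Q\<^esub> Y)"
      "X \<otimes>\<^bsub>Q\<^esub> (c \<odot>\<^bsub>Q\<^esub> Y) = c \<odot>\<^bsub>Q\<^esub> (X \<otimes>\<^bsub>Q\<^esub> Y)"
      using xy by (simp_all add: Q_ops Q_smult smult_r_distr smult_assoc_l smult_assoc_r)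
  qed
  ultimately show ?thesis by (rule unital_algebra.intro)
qed

end

end

text \<open>The Peirce conditions are equations holding for all elements, up to the choice of a
  scalar or of one of two alternatives. They hold for representatives and therefore for their
  cosets.\<close>

lemma (in peirce) peirce_quotient:
  assumes I: "ideal I A"
  shows "peirce (quotient_algebra A I) V (\<lambda>i. I +> e i)"
proof -
  let ?Q = "quotient_algebra A I"
  interpret Q: unital_algebra ?Q using I by (rule unital_algebra_quotient)
  note cosets = Q_cosets[OF I] and ops = Q_ops[OF I] Q_smult[OF I]
  have finsum: "(\<Oplus>\<^bsub>?Q\<^esub>i\<in>J. I +> e i) = I +> (\<Oplus>i\<in>J. e i)" if "finite J" "J \<subseteq> V" for J
    using that
  proof (induction J rule: finite_induct)
    case empty
    show ?case by (simp add: ops)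
  next
    case (insert j J)
    then have "(\<lambda>i. I +> e i) \<in> J \<rightarrow> carrier ?Q" "e \<in> J \<rightarrow> carrier A" "j \<in> V" "J \<subseteq> V"
      using cosets by auto
    then show ?case using insert cosets
      by (simp add: Q.finsum_insert finsum_insert ops finsum_closed)
  qed
  show ?thesis
  proof (intro peirce.intro Q.unital_algebra_axioms peirce_axioms.intro finite_V)
    fix i X assume "i \<in> V" "X \<in> carrier ?Q"
    moreover from this obtain x where "x \<in> carrier A" "X = I +> x" using cosets(1) by blast
    ultimately show "\<exists>c. (I +> e i) \<otimes>\<^bsub>?Q\<^esub> X \<otimes>\<^bsub>?Q\<^esub> (I +> e i) = c \<odot>\<^bsub>?Q\<^esub> (I +> e i)"
      using corner[of i x] by (auto simp: ops)
  next
    fix i j X Y assume ij: "i \<in> V" "j \<in> V" "i \<noteq> j" and "X \<in> carrier ?Q" "Y \<in> carrier ?Q"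
    then obtain x y where "x \<in> carrier A" "X = I +> x" "y \<in> carrier A" "Y = I +> y"
      using cosets(1) by meson
    then show "(I +> e i) \<otimes>\<^bsub>?Q\<^esub> X \<otimes>\<^bsub>?Q\<^esub> (I +> e j) = \<zero>\<^bsub>?Q\<^esub> \<or>
        (I +> e j) \<otimes>\<^bsub>?Q\<^esub> Y \<otimes>\<^bsub>?Q\<^esub> (I +> e i) = \<zero>\<^bsub>?Q\<^esub>"
      using acyclic[OF ij, of x y] ij by (auto simp: ops)
  qed (use finsum[OF finite_V] e_sum cosets in \<open>auto simp: ops e_mult\<close>)
qed

text \<open>Uniqueness is asserted on the carrier, since maps are total functions whose values
  elsewhere carry no meaning.\<close>

theorem theorem4p4:
  fixes \<Gamma> :: "('v, 'e) pre_digraph"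
    and \<rho> :: "(('v, 'e) path \<Rightarrow> 'k::field) set"
    and \<Theta> :: "(('v, 'e) path \<Rightarrow> 'k) set \<Rightarrow> (('v, 'e) path \<Rightarrow> 'k) set"
  defines "\<Lambda> \<equiv> path_algebra_rel \<Gamma> \<rho>"
  assumes "fin_digraph \<Gamma>"
    and "\<not> (\<exists>p. oriented_cycle \<Gamma> p)"
    and "\<forall>r\<in>\<rho>. is_relation \<Gamma> r"
    and "lie_derivation \<Lambda> \<Theta>"
  shows "(\<exists>D \<Phi>. standard_decomposition \<Lambda> \<Theta> D \<Phi>) \<and>
    (\<forall>D \<Phi> D' \<Phi>'. standard_decomposition \<Lambda> \<Theta> D \<Phi> \<longrightarrow> standard_decomposition \<Lambda> \<Theta> D' \<Phi>' \<longrightarrow>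
       (\<forall>a\<in>carrier \<Lambda>. D a = D' a \<and> \<Phi> a = \<Phi>' a))"
proof -
  interpret P: peirce "path_algebra \<Gamma> :: ('k, ('v, 'e) path \<Rightarrow> 'k) module" "verts \<Gamma>" vertex_idempotent
    using assms(2,3) by (rule fin_digraph.peirce_path_algebra)
  have "\<rho> \<subseteq> carrier (path_algebra \<Gamma>)"
    using assms(4) unfolding is_relation_def by blast
  then have "ideal (Idl\<^bsub>path_algebra \<Gamma>\<^esub> \<rho>) (path_algebra \<Gamma>)"
    by (rule P.genideal_ideal)
  then interpret \<Lambda>: peirce \<Lambda> "verts \<Gamma>"
      "\<lambda>i. Idl\<^bsub>path_algebra \<Gamma>\<^esub> \<rho> +>\<^bsub>path_algebra \<Gamma>\<^esub> vertex_idempotent i"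
    unfolding \<Lambda>_def path_algebra_rel_def by (rule P.peirce_quotient)
  show ?thesis
    using \<Lambda>.lie_derivation_standard[OF assms(5)] \<Lambda>.standard_decomposition_unique by blast
qed

end
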